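(* There exists a family of Boolean functions $\{g_k:\{0,1\}^{n_k}\to\{0,1\}\mid k\in\mathbb{N}\}$ such that $\mathsf{alt}(g_k)\ge \mathsf{s}(g_k)^{\log_3 5}$ for every $k$, while $\mathsf{DT}(g_k)=\Omega(n_k^{\log_6 3})$.
   Context: For $x,y\in\{0,1\}^n$ write $x\prec y$ if $x_i\le y_i$ for all $i$. A chain is a sequence of distinct inputs $0^n=x_0\prec x_1\prec\dots\prec x_n=1^n$. For a chain $\mathcal C$, $\mathsf{alt}(f,\mathcal C)=|\{i\in[n]: f(x_{i-1})\ne f(x_i)\}|$, and $\mathsf{alt}(f)$ is the maximum of $\mathsf{alt}(f,\mathcal C)$ over all chains. $\mathsf{s}(f)=\max_x|\{i: f(x\oplus e_i)\ne f(x)\}|$ is the sensitivity. $\mathsf{DT}(f)$ is the minimum depth of a deterministic decision tree computing $f$. *)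

theory Defs
  imports Complex_Main "HOL-Library.FuncSet" "HOL-Library.Landau_Symbols"
begin

text \<open>
  Coordinates are indexed by \<open>0, \<dots>, n - 1\<close>. A Boolean function on \<open>n\<close> bits is an
  \<open>f :: (nat \<Rightarrow> bool) \<Rightarrow> bool\<close>; every measure below depends on \<open>f\<close> only through its
  values on \<open>cube n\<close>.
\<close>

definition cube :: "nat \<Rightarrow> (nat \<Rightarrow> bool) set" where
  "cube n = {..<n} \<rightarrow>\<^sub>E (UNIV :: bool set)"

definition flip :: "(nat \<Rightarrow> bool) \<Rightarrow> nat \<Rightarrow> nat \<Rightarrow> bool" where
  "flip x i = x(i := \<not> x i)"

definition cube_le :: "nat \<Rightarrow> (nat \<Rightarrow> bool) \<Rightarrow> (nat \<Rightarrow> bool) \<Rightarrow> bool" where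
  "cube_le n x y \<longleftrightarrow> (\<forall>i<n. x i \<le> y i)"

text \<open>Only the values \<open>c 0, \<dots>, c n\<close> of the sequence matter.\<close>

definition is_chain :: "nat \<Rightarrow> (nat \<Rightarrow> nat \<Rightarrow> bool) \<Rightarrow> bool" where
  "is_chain n c \<longleftrightarrow>
     c ` {..n} \<subseteq> cube n \<and> inj_on c {..n} \<and>
     c 0 = (\<lambda>i\<in>{..<n}. False) \<and> c n = (\<lambda>i\<in>{..<n}. True) \<and>
     (\<forall>i<n. cube_le n (c i) (c (Suc i)))"

definition alt_chain ::
  "nat \<Rightarrow> ((nat \<Rightarrow> bool) \<Rightarrow> bool) \<Rightarrow> (nat \<Rightarrow> nat \<Rightarrow> bool) \<Rightarrow> nat" where
  "alt_chain n f c = card {i \<in> {1..n}. f (c (i - 1)) \<noteq> f (c i)}"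

definition alternation :: "nat \<Rightarrow> ((nat \<Rightarrow> bool) \<Rightarrow> bool) \<Rightarrow> nat" where
  "alternation n f = Max {alt_chain n f c | c. is_chain n c}"

definition sensitivity :: "nat \<Rightarrow> ((nat \<Rightarrow> bool) \<Rightarrow> bool) \<Rightarrow> nat" where
  "sensitivity n f = Max ((\<lambda>x. card {i \<in> {..<n}. f (flip x i) \<noteq> f x}) ` cube n)"

text \<open>\<open>Query i t0 t1\<close> reads coordinate \<open>i\<close> and continues with \<open>t0\<close> on 0 and \<open>t1\<close> on 1.\<close>

datatype dtree = Answer bool | Query nat dtree dtree

primrec eval_dtree :: "dtree \<Rightarrow> (nat \<Rightarrow> bool) \<Rightarrow> bool" where
  "eval_dtree (Answer b) x = b"
| "eval_dtree (Query i t0 t1) x = (if x i then eval_dtree t1 x else eval_dtree t0 x)"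

primrec depth :: "dtree \<Rightarrow> nat" where
  "depth (Answer b) = 0"
| "depth (Query i t0 t1) = Suc (max (depth t0) (depth t1))"

primrec queried :: "dtree \<Rightarrow> nat set" where
  "queried (Answer b) = {}"
| "queried (Query i t0 t1) = insert i (queried t0 \<union> queried t1)"

definition computes :: "nat \<Rightarrow> dtree \<Rightarrow> ((nat \<Rightarrow> bool) \<Rightarrow> bool) \<Rightarrow> bool" where
  "computes n t f \<longleftrightarrow> queried t \<subseteq> {..<n} \<and> (\<forall>x\<in>cube n. eval_dtree t x = f x)"

definition DT :: "nat \<Rightarrow> ((nat \<Rightarrow> bool) \<Rightarrow> bool) \<Rightarrow> nat" where
  "DT n f = (LEAST d. \<exists>t. computes n t f \<and> depth t = d)"

end

theory Submission
  imports Defs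
begin

text \<open>
  Take the complete binary decision tree of depth \<open>d\<close> in which all \<open>2 ^ d - 1\<close> nodes query
  distinct variables, numbered in in-order, and whose leaves are labelled alternately. An input
  is sensitive only at the \<open>d\<close> variables on its path, whereas switching the variables on in
  in-order visits the leaves from left to right and so alternates at every step. Adding modulo 2
  the parity of \<open>m\<close> fresh variables keeps every step of this chain alternating, raises the
  sensitivity to at most \<open>d + m\<close>, and forces every decision tree to have depth at least \<open>m\<close>.
  With \<open>d = 3 * k\<close> and \<open>m = 4 ^ k - 3 * k\<close> the number of variables, hence the alternation, is at
  least \<open>8 ^ k\<close> and at most \<open>2 * 8 ^ k\<close>, while the sensitivity is at most \<open>4 ^ k\<close>. The theorem
  follows from \<open>log 3 5 \<le> 3/2\<close> and \<open>log 6 3 \<le> 2/3\<close>.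
\<close>

section \<open>Measures of Boolean functions\<close>

lemma finite_cube: "finite (cube n)"
  unfolding cube_def by (intro finite_PiE) auto

lemma sensitivity_le:
  assumes "\<And>x. card {i \<in> {..<n}. f (flip x i) \<noteq> f x} \<le> b"
  shows "sensitivity n f \<le> b"
proof -
  have "cube n \<noteq> {}"
    by (simp add: cube_def PiE_eq_empty_iff)
  then show ?thesis
    unfolding sensitivity_def using assms finite_cube by (subst Max_le_iff) auto
qed

lemma alt_chain_le: "alt_chain n f c \<le> n"
proof -
  have "alt_chain n f c \<le> card {1..n}"
    unfolding alt_chain_def by (intro card_mono) auto
  then show ?thesis by simp
qed

definition prefix_chain :: "nat \<Rightarrow> nat \<Rightarrow> nat \<Rightarrow> bool" where
  "prefix_chain n i = (\<lambda>j\<in>{..<n}. j < i)"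

lemma is_chain_prefix_chain: "is_chain n (prefix_chain n)"
proof -
  have "inj_on (prefix_chain n) {..n}"
  proof (rule linorder_inj_onI)
    fix i j :: nat
    assume "i < j" "i \<in> {..n}" "j \<in> {..n}"
    then have "prefix_chain n i i \<noteq> prefix_chain n j i"
      by (simp add: prefix_chain_def)
    then show "prefix_chain n i \<noteq> prefix_chain n j" by metis
  qed auto
  moreover have "prefix_chain n ` {..n} \<subseteq> cube n"
    by (auto simp: prefix_chain_def cube_def)
  moreover have "prefix_chain n n = (\<lambda>i\<in>{..<n}. True)"
    by (auto simp: prefix_chain_def restrict_def)
  ultimately show ?thesis
    by (auto simp: is_chain_def cube_le_def prefix_chain_def)
qed

lemma alternation_ge_if_alternates_on_prefixes:
  assumes "\<And>i. i \<le> n \<Longrightarrow> f (prefix_chain n i) = odd i"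
  shows "n \<le> alternation n f"
proof -
  have "{i \<in> {1..n}. f (prefix_chain n (i - 1)) \<noteq> f (prefix_chain n i)} = {1..n}"
    using assms by auto
  then have "alt_chain n f (prefix_chain n) = n"
    by (simp add: alt_chain_def)
  moreover have "finite {alt_chain n f c | c. is_chain n c}"
    by (rule finite_subset[of _ "{..n}"]) (auto simp: alt_chain_le)
  ultimately show ?thesis
    unfolding alternation_def using is_chain_prefix_chain by (intro Max_ge) force+
qed

text \<open>A flip can change the answer only if its variable is queried on the path of
  \<open>x\<close>. The induction follows this path and drops the root variable from
  \<open>S\<close>.\<close>

lemma card_sensitive_le_depth:
  assumes "finite S" "\<And>i. i \<in> S \<Longrightarrow> eval_dtree t (flip x i) \<noteq> eval_dtree t x"
  shows "card S \<le> depth t"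
  using assms
proof (induction t arbitrary: S)
  case (Answer b)
  then have "S = {}" by auto
  then show ?case by simp
next
  case (Query j t0 t1)
  define t where "t = (if x j then t1 else t0)"
  have "eval_dtree t (flip x i) \<noteq> eval_dtree t x" if "i \<in> S - {j}" for i
  proof -
    have "flip x i j = x j"
      using that by (simp add: flip_def)
    then show ?thesis
      using Query.prems(2)[of i] that by (simp add: t_def split: if_splits)
  qed
  moreover have "finite (S - {j})"
    using Query.prems(1) by simp
  ultimately have "card (S - {j}) \<le> depth t"
    using Query.IH unfolding t_def by presburger
  moreover have "card S \<le> Suc (card (S - {j}))"
    by (cases "j \<in> S") (simp_all add: card_Diff_singleton_if)
  ultimately show ?case
    by (auto simp: t_def split: if_splits)
qed

text \<open>Ensures that the \<open>LEAST\<close> in \<open>DT\<close> is attained. With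
  \<open>restrict\<close> the equation holds for every \<open>x\<close>, so the induction carries no
  membership condition.\<close>

lemma ex_dtree:
  "\<exists>t. queried t \<subseteq> {..<n} \<and> (\<forall>x. eval_dtree t x = f (restrict x {..<n}))"
proof (induction n arbitrary: f)
  case 0
  have "queried (Answer (f (\<lambda>_. undefined))) \<subseteq> {..<0}
      \<and> (\<forall>x. eval_dtree (Answer (f (\<lambda>_. undefined))) x = f (restrict x {..<0}))"
    by (simp add: restrict_def)
  then show ?case by blast
next
  case (Suc n)
  \<comment> \<open>\<open>T b\<close> handles \<open>f\<close> with coordinate \<open>n\<close>
    fixed to \<open>b\<close>; a root query of \<open>n\<close> joins the two trees.\<close>
  obtain T where T: "queried (T b) \<subseteq> {..<n}"
    "\<And>x. eval_dtree (T b) x = f ((restrict x {..<n})(n := b))" for b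
    using Suc.IH[of "\<lambda>x. f (x(n := _))"] by metis
  have "(restrict x {..<n})(n := x n) = restrict x {..<Suc n}" for x :: "nat \<Rightarrow> bool"
    by (rule ext) (simp add: restrict_def less_Suc_eq)
  then have "eval_dtree (Query n (T False) (T True)) x = f (restrict x {..<Suc n})" for x
    by (cases "x n") (metis T(2) eval_dtree.simps(2))+
  moreover have "queried (Query n (T False) (T True)) \<subseteq> {..<Suc n}"
    using T(1)[of True] T(1)[of False] by auto
  ultimately show ?case by blast
qed

lemma card_sensitive_le_DT:
  assumes "S \<subseteq> {..<n}" "x \<in> cube n" "\<And>i. i \<in> S \<Longrightarrow> f (flip x i) \<noteq> f x"
  shows "card S \<le> DT n f"
proof -
  obtain t where t: "queried t \<subseteq> {..<n}" "\<And>x. eval_dtree t x = f (restrict x {..<n})"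
    using ex_dtree by metis
  then have "computes n t f"
    by (auto simp: computes_def cube_def PiE_restrict)
  then obtain u where u: "computes n u f" "depth u = DT n f"
    using LeastI[of "\<lambda>d. \<exists>t. computes n t f \<and> depth t = d" "depth t"]
    unfolding DT_def by blast
  have "eval_dtree u (flip x i) \<noteq> eval_dtree u x" if "i \<in> S" for i
  proof -
    have "flip x i \<in> cube n"
      using assms(1,2) that by (auto simp: cube_def flip_def PiE_iff extensional_def)
    then show ?thesis
      using u(1) assms(2,3) that by (auto simp: computes_def)
  qed
  then show ?thesis
    using card_sensitive_le_depth[of S u x] u(2) assms(1) finite_subset by auto
qed

section \<open>The in-order decision tree\<close>

text \<open>
  The subtree of height \<open>d\<close> whose leftmost leaf has number \<open>a\<close> owns the variables
  \<open>a, \<dots>, a + 2 ^ d - 2\<close>; its root is the middle one.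
\<close>

primrec inorder_tree :: "nat \<Rightarrow> nat \<Rightarrow> (nat \<Rightarrow> bool) \<Rightarrow> bool" where
  "inorder_tree 0 a x = odd a"
| "inorder_tree (Suc d) a x =
     (if x (a + 2 ^ d - 1) then inorder_tree d (a + 2 ^ d) x else inorder_tree d a x)"

primrec inorder_path :: "nat \<Rightarrow> nat \<Rightarrow> (nat \<Rightarrow> bool) \<Rightarrow> nat set" where
  "inorder_path 0 a x = {}"
| "inorder_path (Suc d) a x = insert (a + 2 ^ d - 1)
     (if x (a + 2 ^ d - 1) then inorder_path d (a + 2 ^ d) x else inorder_path d a x)"

lemma finite_inorder_path: "finite (inorder_path d a x)"
  by (induction d arbitrary: a) auto

lemma card_inorder_path_le: "card (inorder_path d a x) \<le> d"
proof (induction d arbitrary: a)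
  case (Suc d)
  then show ?case
    by (auto intro!: card_insert_le_m1)
qed simp

text \<open>Keeps the path disjoint from the parity variables, which start at
  \<open>2 ^ d - 1\<close> when \<open>a = 0\<close>.\<close>

lemma inorder_path_subset: "inorder_path d a x \<subseteq> {a..<a + 2 ^ d - 1}"
proof (induction d arbitrary: a)
  case (Suc d)
  have pos: "(2::nat) ^ d \<ge> 1" by simp
  then have "{a..<a + 2 ^ d - 1} \<subseteq> {a..<a + 2 ^ Suc d - 1}"
    "{a + 2 ^ d..<a + 2 ^ d + 2 ^ d - 1} \<subseteq> {a..<a + 2 ^ Suc d - 1}"
    unfolding power_Suc by (intro ivl_subset[THEN iffD2] disjI2 conjI; linarith)+
  moreover have "a + 2 ^ d - 1 \<in> {a..<a + 2 ^ Suc d - 1}"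
    unfolding power_Suc atLeastLessThan_iff using pos by linarith
  ultimately show ?case
    using Suc[of a] Suc[of "a + 2 ^ d"] unfolding inorder_path.simps
    by (smt (verit) insert_subset order_trans)
qed simp

lemma inorder_tree_flip:
  "i \<notin> inorder_path d a x \<Longrightarrow> inorder_tree d a (flip x i) = inorder_tree d a x"
  by (induction d arbitrary: a) (auto simp: flip_def split: if_splits)

text \<open>Binary search: a root is on exactly when \<open>i\<close> lies in the right half of the
  leaves, so the evaluation ends at leaf number \<open>i\<close>.\<close>

lemma inorder_tree_prefix:
  assumes "a \<le> i" "i < a + 2 ^ d" "\<And>j. j < a + 2 ^ d - 1 \<Longrightarrow> x j \<longleftrightarrow> j < i"
  shows "inorder_tree d a x = odd i"
  using assms
proof (induction d arbitrary: a)
  case (Suc d)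
  have pos: "(2::nat) ^ d \<ge> 1" by simp
  then have "a + 2 ^ d - 1 < a + 2 ^ Suc d - 1"
    unfolding power_Suc by linarith
  then have "x (a + 2 ^ d - 1) \<longleftrightarrow> a + 2 ^ d - 1 < i"
    by (rule Suc.prems(3))
  then have root: "x (a + 2 ^ d - 1) \<longleftrightarrow> a + 2 ^ d \<le> i"
    using pos by linarith
  show ?case
  proof (cases "a + 2 ^ d \<le> i")
    case True
    then have "inorder_tree d (a + 2 ^ d) x = odd i"
      using Suc.prems by (intro Suc.IH) auto
    with True root show ?thesis by simp
  next
    case False
    then have "inorder_tree d a x = odd i"
      using Suc.prems by (intro Suc.IH) auto
    with False root show ?thesis by simp
  qed
qed (simp add: le_less_Suc_eq)

section \<open>Adding a parity\<close>

definition parity_on :: "nat set \<Rightarrow> (nat \<Rightarrow> bool) \<Rightarrow> bool" where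
  "parity_on A x = odd (card {j \<in> A. x j})"

lemma parity_on_flip_in:
  assumes "finite A" "i \<in> A"
  shows "parity_on A (flip x i) \<noteq> parity_on A x"
proof (cases "x i")
  case True
  have "{j \<in> A. x j} = insert i {j \<in> A. flip x i j}"
    using assms True by (auto simp: flip_def)
  moreover have "i \<notin> {j \<in> A. flip x i j}"
    using True by (simp add: flip_def)
  ultimately show ?thesis
    using assms by (simp add: parity_on_def)
next
  case False
  have "{j \<in> A. flip x i j} = insert i {j \<in> A. x j}"
    using assms False by (auto simp: flip_def)
  then show ?thesis
    using assms False by (simp add: parity_on_def)
qed

definition tree_parity :: "nat \<Rightarrow> nat \<Rightarrow> (nat \<Rightarrow> bool) \<Rightarrow> bool" where
  "tree_parity d m x \<longleftrightarrow> inorder_tree d 0 x \<noteq> parity_on {2 ^ d - 1..<2 ^ d - 1 + m} x"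

lemma alternation_tree_parity:
  "2 ^ d - 1 + m \<le> alternation (2 ^ d - 1 + m) (tree_parity d m)"
proof (rule alternation_ge_if_alternates_on_prefixes)
  fix i
  define N n :: nat where "N = 2 ^ d - 1" and "n = N + m"
  assume "i \<le> 2 ^ d - 1 + m"
  then have i: "i \<le> n" by (simp add: n_def N_def)
  have N: "Suc N = 2 ^ d" by (simp add: N_def)
  \<comment> \<open>The prefix switches on \<open>min i N\<close> tree variables and
    \<open>i - N\<close> parity variables (truncated subtraction). These counts add up to
    \<open>i\<close>, so the two parities combine to \<open>odd i\<close>.\<close>
  have "inorder_tree d 0 (prefix_chain n i) = odd (min i N)"
    by (rule inorder_tree_prefix) (auto simp: prefix_chain_def n_def simp flip: N)
  moreover have "{j \<in> {N..<n}. prefix_chain n i j} = {N..<i}"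
    using i by (auto simp: prefix_chain_def)
  then have "parity_on {N..<n} (prefix_chain n i) = odd (i - N)"
    by (simp add: parity_on_def)
  ultimately have "tree_parity d m (prefix_chain n i) = odd i"
    unfolding tree_parity_def N_def[symmetric] n_def[symmetric] by (cases "i \<le> N") auto
  then show "tree_parity d m (prefix_chain (2 ^ d - 1 + m) i) = odd i"
    by (simp add: n_def N_def)
qed

lemma sensitivity_tree_parity:
  "sensitivity (2 ^ d - 1 + m) (tree_parity d m) \<le> d + m"
proof (rule sensitivity_le)
  fix x
  let ?A = "{2 ^ d - 1..<2 ^ d - 1 + m}"
  let ?S = "{i \<in> {..<2 ^ d - 1 + m}. tree_parity d m (flip x i) \<noteq> tree_parity d m x}"
  have "parity_on ?A (flip x i) = parity_on ?A x" if "i \<notin> ?A" for i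
    unfolding parity_on_def using that
    by (intro arg_cong[where f = "\<lambda>B. odd (card B)"]) (auto simp: flip_def)
  then have "?S \<subseteq> inorder_path d 0 x \<union> ?A"
    using inorder_tree_flip[of _ d 0 x] unfolding tree_parity_def by blast
  then have "card ?S \<le> card (inorder_path d 0 x \<union> ?A)"
    by (intro card_mono) (auto simp: finite_inorder_path)
  also have "\<dots> \<le> card (inorder_path d 0 x) + card ?A"
    by (rule card_Un_le)
  also have "\<dots> \<le> d + m"
    using card_inorder_path_le[of d 0 x] by simp
  finally show "card ?S \<le> d + m" .
qed

text \<open>Parity variables lie outside the tree, so each is sensitive at every input; the all-zero
  input is one choice.\<close>

lemma DT_tree_parity: "m \<le> DT (2 ^ d - 1 + m) (tree_parity d m)"
proof -
  let ?A = "{2 ^ d - 1..<2 ^ d - 1 + m}"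
  let ?x = "prefix_chain (2 ^ d - 1 + m) 0"
  have "card ?A \<le> DT (2 ^ d - 1 + m) (tree_parity d m)"
  proof (rule card_sensitive_le_DT)
    show "?x \<in> cube (2 ^ d - 1 + m)"
      by (auto simp: prefix_chain_def cube_def)
    fix i assume i: "i \<in> ?A"
    then have "i \<notin> inorder_path d 0 ?x"
      using inorder_path_subset[of d 0 ?x] by auto
    then show "tree_parity d m (flip ?x i) \<noteq> tree_parity d m ?x"
      using parity_on_flip_in[of ?A i ?x] i by (simp add: tree_parity_def inorder_tree_flip)
  qed auto
  then show ?thesis by simp
qed

section \<open>Choice of parameters\<close>

text \<open>Amounts to \<open>5 ^ 2 \<le> 3 ^ 3\<close>.\<close>

lemma log_3_5_le: "log 3 5 \<le> 3 / 2"
proof -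
  have "2 * log 3 5 = log 3 (5 ^ 2)"
    by (subst log_nat_power) auto
  also have "\<dots> \<le> log 3 (3 ^ 3)"
    by (subst log_le_cancel_iff) auto
  also have "\<dots> = 3"
    by (subst log_nat_power) auto
  finally show ?thesis by simp
qed

text \<open>Amounts to \<open>3 ^ 3 \<le> 6 ^ 2\<close>.\<close>

lemma log_6_3_le: "log 6 3 \<le> 2 / 3"
proof -
  have "3 * log 6 3 = log 6 (3 ^ 3)"
    by (subst log_nat_power) auto
  also have "\<dots> \<le> log 6 (6 ^ 2)"
    by (subst log_le_cancel_iff) auto
  also have "\<dots> = 2"
    by (subst log_nat_power) auto
  finally show ?thesis by simp
qed

text \<open>Makes the subtraction in \<open>4 ^ k - 3 * k\<close> exact and its result
  positive.\<close>

lemma linear_less_4_power: "3 * k + 1 \<le> (4::nat) ^ k"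
  by (induction k) auto

lemma powr_4_8: "((4::real) ^ k) powr (3 / 2) = 8 ^ k" "((8::real) ^ k) powr (2 / 3) = 4 ^ k"
proof -
  have "2 powr (2 * real k) = (2 powr 2) powr real k"
    by (rule powr_powr[symmetric])
  then have 4: "(4::real) ^ k = 2 powr (2 * real k)"
    by (simp add: powr_realpow)
  have "2 powr (3 * real k) = (2 powr 3) powr real k"
    by (rule powr_powr[symmetric])
  then have 8: "(8::real) ^ k = 2 powr (3 * real k)"
    by (simp add: powr_realpow)
  show "((4::real) ^ k) powr (3 / 2) = 8 ^ k" "((8::real) ^ k) powr (2 / 3) = 4 ^ k"
    unfolding 4 8 powr_powr by simp_all
qed

theorem theorem2:
  "\<exists>(n :: nat \<Rightarrow> nat) (g :: nat \<Rightarrow> (nat \<Rightarrow> bool) \<Rightarrow> bool).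
     filterlim n at_top sequentially \<and>
     (\<forall>k. real (alternation (n k) (g k)) \<ge> real (sensitivity (n k) (g k)) powr log 3 5) \<and>
     (\<lambda>k. real (DT (n k) (g k))) \<in> \<Omega>(\<lambda>k. real (n k) powr log 6 3)"
proof -
  define m :: "nat \<Rightarrow> nat" where "m k = 4 ^ k - 3 * k" for k
  define n :: "nat \<Rightarrow> nat" where "n k = 2 ^ (3 * k) - 1 + m k" for k
  define g where "g k = tree_parity (3 * k) (m k)" for k
  have pow8: "2 ^ (3 * k) = (8::nat) ^ k" for k
    by (simp add: power_mult)
  have m: "3 * k + m k = 4 ^ k" "1 \<le> m k" for k
    using linear_less_4_power[of k] by (auto simp: m_def)
  have n_ge: "8 ^ k \<le> n k" for k
    using m(2)[of k] by (simp add: n_def pow8)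
  have n_le: "n k \<le> 2 * 8 ^ k" for k
  proof -
    have "(4::nat) ^ k \<le> 8 ^ k"
      by (rule power_mono) auto
    then show ?thesis
      using m(1)[of k] unfolding n_def pow8 by linarith
  qed
  have m_ge: "4 ^ k \<le> 4 * m k" for k
  proof -
    \<comment> \<open>The tree depth \<open>3 * k\<close> takes at most three quarters of
      \<open>4 ^ k\<close>, leaving at least a quarter for \<open>m k\<close>.\<close>
    have "4 * (3 * k) \<le> 3 * (4::nat) ^ k"
      using linear_less_4_power[of "k - 1"] by (cases k) auto
    then show ?thesis using m(1)[of k] by linarith
  qed

  have "filterlim n at_top sequentially"
  proof (rule filterlim_at_top_mono[OF filterlim_ident])
    have "k \<le> n k" for k
      using n_ge[of k] less_exp[of k] power_mono[of "2::nat" 8 k] by linarith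
    then show "\<forall>\<^sub>F k in sequentially. k \<le> n k" by simp
  qed

  moreover have "real (sensitivity (n k) (g k)) powr log 3 5 \<le> real (alternation (n k) (g k))" for k
  proof -
    have "sensitivity (n k) (g k) \<le> 4 ^ k"
      using sensitivity_tree_parity[of "3 * k" "m k"] m(1)[of k] by (simp add: n_def g_def)
    then have "real (sensitivity (n k) (g k)) \<le> 4 ^ k"
      by (metis of_nat_le_iff of_nat_numeral of_nat_power)
    then have "real (sensitivity (n k) (g k)) powr log 3 5 \<le> (4 ^ k) powr log 3 5"
      by (intro powr_mono2) auto
    also have "\<dots> \<le> (4 ^ k) powr (3 / 2)"
      by (intro powr_mono log_3_5_le) auto
    also have "\<dots> = 8 ^ k"
      by (rule powr_4_8)
    also have "\<dots> \<le> real (n k)"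
      using n_ge[of k] by (metis of_nat_le_iff of_nat_numeral of_nat_power)
    also have "\<dots> \<le> real (alternation (n k) (g k))"
      using alternation_tree_parity[of "3 * k" "m k"] by (simp add: n_def g_def)
    finally show ?thesis .
  qed

  moreover have "(\<lambda>k. real (DT (n k) (g k))) \<in> \<Omega>(\<lambda>k. real (n k) powr log 6 3)"
  \<comment> \<open>The 8 is a factor 2 bounding \<open>2 powr (2 / 3)\<close>, which comes from
    \<open>n k \<le> 2 * 8 ^ k\<close>, times the 4 in \<open>4 ^ k \<le> 4 * m k\<close>.\<close>
  proof (rule landau_omega.bigI[of "1 / 8"])
    have "1 / 8 * (real (n k) powr log 6 3) \<le> real (DT (n k) (g k))" for k
    proof -
      have n1: "1 \<le> real (n k)"
        using n_ge[of k] by (metis le_trans of_nat_1 of_nat_mono one_le_numeral one_le_power)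
      have "real (n k) powr log 6 3 \<le> real (n k) powr (2 / 3)"
        using n1 by (intro powr_mono log_6_3_le) auto
      also have "\<dots> \<le> (2 * 8 ^ k) powr (2 / 3)"
      proof (rule powr_mono2)
        have "real (n k) \<le> real (2 * 8 ^ k)"
          using n_le[of k] of_nat_le_iff by blast
        then show "real (n k) \<le> 2 * 8 ^ k" by simp
      qed auto
      also have "\<dots> = 2 powr (2 / 3) * 4 ^ k"
        by (simp add: powr_mult powr_4_8)
      also have "\<dots> \<le> 2 * 4 ^ k"
        using powr_mono[of "2 / 3" 1 "2::real"] by (intro mult_right_mono) auto
      also have "\<dots> \<le> 8 * real (m k)"
      proof -
        have "real (4 ^ k) \<le> real (4 * m k)"
          using m_ge[of k] of_nat_le_iff by blast
        then show ?thesis by simp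
      qed
      also have "\<dots> \<le> 8 * real (DT (n k) (g k))"
        using DT_tree_parity[of "m k" "3 * k"] by (simp add: n_def g_def)
      finally show ?thesis by simp
    qed
    then show "\<forall>\<^sub>F k in sequentially.
        1 / 8 * norm (real (n k) powr log 6 3) \<le> norm (real (DT (n k) (g k)))"
      by simp
  qed simp

  ultimately show ?thesis by blast
qed

end
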